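(* Let $G_{n_1}$ with vertex set $\{0\}\cup[n_1]$ and $G_{n_2}$ with vertex set $\{0\}\cup[n_2]$ be two partially completed star-graphs such that each of them has at least one triangle. Suppose that $G_{n_1}$ and $G_{n_2}$ are glued together at a vertex that is not the center: i.e. take disjoint copies of the two graphs, and identify a non-center vertex of $G_{n_1}$ with a non-center vertex of $G_{n_2}$, the edge set of the glued graph being the union of the two edge sets. Then the glued graph (which has $n_1+n_2+1$ vertices) again satisfies the Triangle Friendship Paradox, i.e. its triangle friendship-bias satisfies $\Delta^T_{[n_1+n_2+1]}\ge0$.
   Context: Triangle friendship-bias. For a finite undirected graph $G$ with vertex set $V$, adjacency matrix $(A_{uv})_{u,v\in V}$, degrees $d_v=\sum_{u}A_{vu}$, and $t_v$ the number of triangles containing $v$, the triangle friendship-bias of the vertex $v$ is $$\Delta^T_v=\Big[\frac1{d_v}\sum_{u\in V}A_{vu}t_u-t_v\Big]\mathbf 1_{\{d_v\ne0\}}.$$ The triangle friendship-bias of $G$ is the average over all vertices, $\Delta^T_{[|V|]}=\frac1{|V|}\sum_{v\in V}\Delta^T_v$. The Triangle Friendship Paradox (TFP) holds for $G$ when $\Delta^T_{[|V|]}\ge0$. Partially completed star-graphs. Let $n>1$. A partially completed star-graph is a graph with vertex set $\{0\}\cup[n]$, $[n]=\{1,\dots,n\}$, and edge set $\{\{0,i\}: i\in[n]\}\cup W$, where $\varnothing\ne W\subsetneq\{\{i,i+1\}: i\in[n]\}$ with the cyclic convention $n+1=1$. By convention the triangle on $\{0,1,2\}$ (with edges $\{0,1\},\{0,2\},\{1,2\}$)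 is also a partially completed star-graph. Vertex $0$ is the center. *)

theory Defs
  imports Complex_Main
begin

datatype 'a ugraph = Ugraph (verts: "'a set") (edges: "'a set set")

definition simple_graph :: "'a ugraph \<Rightarrow> bool" where
  "simple_graph G \<longleftrightarrow> finite (verts G) \<and> (\<forall>e\<in>edges G. e \<subseteq> verts G \<and> card e = 2)"

(* The diagonal vanishes for simple graphs, since a loop would be the singleton {u}. *)
definition adj :: "'a ugraph \<Rightarrow> 'a \<Rightarrow> 'a \<Rightarrow> nat" where
  "adj G u v = (if {u, v} \<in> edges G then 1 else 0)"

definition vertex_degree :: "'a ugraph \<Rightarrow> 'a \<Rightarrow> nat" where
  "vertex_degree G v = (\<Sum>u\<in>verts G. adj G v u)"

definition triangles :: "'a ugraph \<Rightarrow> 'a set set" where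
  "triangles G = {T. T \<subseteq> verts G \<and> card T = 3 \<and>
     (\<forall>u\<in>T. \<forall>v\<in>T. u \<noteq> v \<longrightarrow> {u, v} \<in> edges G)}"

definition triangle_count :: "'a ugraph \<Rightarrow> 'a \<Rightarrow> nat" where
  "triangle_count G v = card {T \<in> triangles G. v \<in> T}"

definition triangle_bias_at :: "'a ugraph \<Rightarrow> 'a \<Rightarrow> real" where
  "triangle_bias_at G v =
     (if vertex_degree G v \<noteq> 0
      then 1 / real (vertex_degree G v) * (\<Sum>u\<in>verts G. real (adj G v u) * real (triangle_count G u))
           - real (triangle_count G v)
      else 0)"

definition triangle_bias :: "'a ugraph \<Rightarrow> real" where
  "triangle_bias G = 1 / real (card (verts G)) * (\<Sum>v\<in>verts G. triangle_bias_at G v)"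

definition triangle_friendship_paradox :: "'a ugraph \<Rightarrow> bool" where
  "triangle_friendship_paradox G \<longleftrightarrow> triangle_bias G \<ge> 0"

definition spokes :: "nat \<Rightarrow> nat set set" where
  "spokes n = {{0, i} | i. i \<in> {1..n}}"

definition rim :: "nat \<Rightarrow> nat set set" where
  "rim n = {{i, if i = n then 1 else i + 1} | i. i \<in> {1..n}}"

(* For n = 2 the rim is the single edge {1,2}, which has no nonempty proper subset;
   the triangle is therefore admitted by a separate clause. *)
definition partially_completed_star :: "nat \<Rightarrow> nat ugraph \<Rightarrow> bool" where
  "partially_completed_star n G \<longleftrightarrow>
     n > 1 \<and> verts G = {0} \<union> {1..n} \<and>
     ((\<exists>W. W \<noteq> {} \<and> W \<subset> rim n \<and> edges G = spokes n \<union> W) \<or>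
      (n = 2 \<and> edges G = {{0, 1}, {0, 2}, {1, 2}}))"

(* Disjoint copies of G and H inside the sum type, with the copy Inr b of b in H
   replaced by the copy Inl a of a in G. *)
definition glue_map :: "'a \<Rightarrow> 'b \<Rightarrow> 'b \<Rightarrow> 'a + 'b" where
  "glue_map a b v = (if v = b then Inl a else Inr v)"

definition glue :: "'a ugraph \<Rightarrow> 'a \<Rightarrow> 'b ugraph \<Rightarrow> 'b \<Rightarrow> ('a + 'b) ugraph" where
  "glue G a H b =
     Ugraph (Inl ` verts G \<union> glue_map a b ` verts H)
            ((`) Inl ` edges G \<union> (`) (glue_map a b) ` edges H)"

lemma inj_glue_map: "inj (glue_map a b)"
  by (auto simp: inj_def glue_map_def)

lemma partially_completed_star_simple:
  assumes "partially_completed_star n G"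
  shows "simple_graph G"
proof -
  have n: "n > 1" and V: "verts G = {0} \<union> {1..n}"
    using assms by (auto simp: partially_completed_star_def)
  have "edges G \<subseteq> spokes n \<union> rim n \<union> {{0, 1}, {0, 2}, {1, 2}}"
    using assms by (auto simp: partially_completed_star_def)
  moreover have "e \<subseteq> verts G \<and> card e = 2" if "e \<in> spokes n" for e
    using that by (auto simp: V spokes_def card_insert_if)
  moreover have "e \<subseteq> verts G \<and> card e = 2" if "e \<in> rim n" for e
  proof -
    obtain i where "e = {i, if i = n then 1 else i + 1}" "1 \<le> i" "i \<le> n"
      using \<open>e \<in> rim n\<close> by (auto simp: rim_def)
    then show ?thesis
      using n by (cases "i = n") (simp_all add: V card_insert_if)
  qed
  moreover have "e \<subseteq> verts G \<and> card e = 2" if "e \<in> {{0, 1}, {0, 2}, {1, 2}}" for e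
    using that n by (elim insertE emptyE) (simp_all add: V card_insert_if)
  ultimately have "\<forall>e\<in>edges G. e \<subseteq> verts G \<and> card e = 2"
    by blast
  then show ?thesis
    by (simp add: simple_graph_def V)
qed

lemma simple_graph_glue:
  assumes "simple_graph G" "simple_graph H"
  shows "simple_graph (glue G a H b)"
proof -
  have "card (glue_map a b ` e) = card e" for e
    by (rule card_image) (metis inj_glue_map inj_on_subset subset_UNIV)
  then show ?thesis
    using assms by (auto simp: simple_graph_def glue_def card_image) blast
qed

end

theory Submission
  imports Defs
begin

text \<open>
  Write \<open>t\<close> for triangle counts and \<open>d\<close> for degrees. A vertex of positive degree satisfies
  \<open>t v = (\<Sum>u\<sim>v. t v) / d v\<close>, so the total bias is the sum of \<open>(t u - t v) / d v\<close> over ordered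
  adjacent pairs; adding to this the same sum with \<open>u\<close> and \<open>v\<close> exchanged gives
  \<open>2 * total bias = (\<Sum>u\<sim>v. (t u - t v) * (1 / d v - 1 / d u))\<close> (\<open>sum_triangle_bias_at\<close>).
  A summand is nonnegative as soon as \<open>t\<close> and \<open>d\<close> do not order its endpoints in opposite ways.
  The sum splits over the edges of the two stars (\<open>edge_form_glue\<close>), and each half turns out to be
  nonnegative on its own (\<open>edge_form_star_nonneg\<close>).

  Consider one star with \<open>n\<close> rim vertices and \<open>w\<close> rim edges, \<open>1 \<le> w < n\<close>, and let \<open>r i\<close> be the
  number of rim edges at \<open>i\<close>. The center has \<open>t = w\<close> and \<open>d = n\<close>; a rim vertex has \<open>t = r i\<close> and
  \<open>d = r i + 1\<close>; the glued vertex has \<open>t = s\<close> and \<open>d = s + 2\<close>, where \<open>s\<close> is the number of rim edges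
  at it in both stars together. Hence \<open>t\<close> and \<open>d\<close> agree on the order of two rim vertices of which
  none is glued, and against the glued vertex they still do not conflict, because for integers
  \<open>s < r i\<close> gives \<open>s + 2 \<le> r i + 1\<close>. So all rim edges contribute nonnegative amounts. So do the
  spokes to the other rim vertices, since \<open>r i \<le> w\<close> and \<open>r i + 1 \<le> n\<close>; only the spoke to the glued
  vertex can be negative, namely when \<open>w < s < n - 2\<close>.
  The other spokes then pay for it. Because \<open>r i \<le> 2\<close>, each of them contributes at least
  \<open>(w - r i) * (1/3 - 1/n)\<close>, and because the \<open>r i\<close> add up to \<open>2 * w\<close>, the factors \<open>w - r i\<close> add up to
  at least \<open>(n - 3) * w \<ge> n - 3\<close>. The deficit is only \<open>(s - w) * (1/(s + 2) - 1/n)\<close>, with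
  \<open>s - w \<le> n - 3\<close> and \<open>s + 2 \<ge> 3\<close>.
\<close>

section \<open>The bias as a sum over edges\<close>

text \<open>Degrees and triangle counts are both incidence numbers, one of the family of edges and
  one of the family of triangles; results on gluing are proved once for such families.\<close>
definition incidence :: "'a set set \<Rightarrow> 'a \<Rightarrow> nat" where
  "incidence F v = card {e \<in> F. v \<in> e}"

text \<open>The sum runs over ordered pairs, so every edge enters twice, with equal summands.\<close>
definition edge_form :: "'a set set \<Rightarrow> ('a \<Rightarrow> real) \<Rightarrow> ('a \<Rightarrow> real) \<Rightarrow> real" where
  "edge_form E t d = (\<Sum>(u, v) | {u, v} \<in> E. (t u - t v) * (1 / d v - 1 / d u))"

lemma vertex_degree_eq_incidence:
  assumes "simple_graph G"
  shows "vertex_degree G v = incidence (edges G) v"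
proof -
  have fin: "finite (verts G)" and sub: "\<And>e. e \<in> edges G \<Longrightarrow> e \<subseteq> verts G \<and> card e = 2"
    using assms by (auto simp: simple_graph_def)
  have "vertex_degree G v = card {u \<in> verts G. {v, u} \<in> edges G}"
    using fin by (simp add: vertex_degree_def adj_def sum.If_cases Int_def)
  also have "bij_betw (\<lambda>u. {v, u}) {u \<in> verts G. {v, u} \<in> edges G} {e \<in> edges G. v \<in> e}"
  proof (rule bij_betw_imageI)
    show "inj_on (\<lambda>u. {v, u}) {u \<in> verts G. {v, u} \<in> edges G}"
      by (auto simp: inj_on_def doubleton_eq_iff)
    have "\<exists>u\<in>verts G. e = {v, u}" if e: "e \<in> edges G" "v \<in> e" for e
    proof -
      obtain x y where "e = {x, y}" using sub[OF e(1)] by (auto simp: card_2_iff)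
      then show ?thesis using e sub[OF e(1)] by (auto simp: insert_commute)
    qed
    then show "(\<lambda>u. {v, u}) ` {u \<in> verts G. {v, u} \<in> edges G} = {e \<in> edges G. v \<in> e}"
      by auto
  qed
  then have "card {u \<in> verts G. {v, u} \<in> edges G} = incidence (edges G) v"
    unfolding incidence_def by (rule bij_betw_same_card)
  finally show ?thesis .
qed

lemma triangle_count_eq_incidence: "triangle_count G v = incidence (triangles G) v"
  by (simp add: triangle_count_def incidence_def)

lemma adj_commute: "adj G u v = adj G v u"
  by (simp add: adj_def insert_commute)

text \<open>Averaging over the neighbours commutes with subtracting the constant \<open>t v\<close>. Division by
  zero yields zero, so the formula also covers isolated vertices.\<close>
lemma triangle_bias_at_eq_sum:
  "triangle_bias_at G v =
     (\<Sum>u\<in>verts G. real (adj G v u) *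
        ((real (triangle_count G u) - real (triangle_count G v)) / real (vertex_degree G v)))"
proof (cases "vertex_degree G v = 0")
  case False
  have "(\<Sum>u\<in>verts G. real (adj G v u) * real (triangle_count G v))
      = real (vertex_degree G v) * real (triangle_count G v)"
    by (simp add: vertex_degree_def sum_distrib_right)
  with False show ?thesis
    by (simp add: triangle_bias_at_def right_diff_distrib sum_subtractf diff_divide_distrib
        flip: sum_divide_distrib)
qed (simp add: triangle_bias_at_def)

lemma sum_triangle_bias_at:
  assumes "simple_graph G"
  shows "2 * (\<Sum>v\<in>verts G. triangle_bias_at G v)
    = edge_form (edges G) (\<lambda>v. real (triangle_count G v)) (\<lambda>v. real (vertex_degree G v))"
proof -
  let ?V = "verts G" and ?A = "\<lambda>u v. real (adj G u v)"
  let ?t = "\<lambda>v. real (triangle_count G v)" and ?d = "\<lambda>v. real (vertex_degree G v)"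
  have fin: "finite ?V" and pairs: "{(u, v). {u, v} \<in> edges G} \<subseteq> ?V \<times> ?V"
    using assms by (auto simp: simple_graph_def)
  have out: "(\<Sum>v\<in>?V. triangle_bias_at G v) = (\<Sum>u\<in>?V. \<Sum>v\<in>?V. ?A u v * ((?t v - ?t u) / ?d u))"
    by (simp add: triangle_bias_at_eq_sum)
  also have "\<dots> = (\<Sum>u\<in>?V. \<Sum>v\<in>?V. ?A u v * ((?t u - ?t v) / ?d v))"
    by (subst sum.swap) (simp add: adj_commute)
  finally have "2 * (\<Sum>v\<in>?V. triangle_bias_at G v)
      = (\<Sum>u\<in>?V. \<Sum>v\<in>?V. ?A u v * ((?t v - ?t u) / ?d u)) + (\<Sum>u\<in>?V. \<Sum>v\<in>?V. ?A u v * ((?t u - ?t v) / ?d v))"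
    using out by simp
  also have "\<dots> = (\<Sum>u\<in>?V. \<Sum>v\<in>?V. ?A u v * ((?t u - ?t v) * (1 / ?d v - 1 / ?d u)))"
    unfolding sum.distrib[symmetric]
    by (intro sum.cong refl) (simp add: algebra_simps diff_divide_distrib)
  also have "\<dots> = (\<Sum>(u, v)\<in>?V \<times> ?V. if {u, v} \<in> edges G
      then (?t u - ?t v) * (1 / ?d v - 1 / ?d u) else 0)"
    unfolding sum.cartesian_product by (intro sum.cong refl) (auto simp: adj_def)
  also have "\<dots> = (\<Sum>(u, v) | {u, v} \<in> edges G. (?t u - ?t v) * (1 / ?d v - 1 / ?d u))"
  proof (rule sum.mono_neutral_cong_right)
    show "finite (?V \<times> ?V)" using fin by simp
  qed (use pairs in \<open>auto split: if_splits\<close>)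
  finally show ?thesis by (simp add: edge_form_def)
qed

lemma edge_form_Un:
  assumes "finite (\<Union> E)" "finite (\<Union> F)" "E \<inter> F = {}"
  shows "edge_form (E \<union> F) t d = edge_form E t d + edge_form F t d"
proof -
  let ?P = "\<lambda>X. {(u, v). {u, v} \<in> X}"
  have "finite (?P X)" if "finite (\<Union> X)" for X :: "'a set set"
    by (rule finite_subset[of _ "\<Union> X \<times> \<Union> X"]) (use that in auto)
  then have "finite (?P E)" "finite (?P F)" using assms by blast+
  moreover have "?P E \<inter> ?P F = {}" using assms(3) by auto
  moreover have "?P (E \<union> F) = ?P E \<union> ?P F" by auto
  ultimately show ?thesis
    unfolding edge_form_def by (simp only: sum.union_disjoint)
qed

text \<open>Along an injective relabelling, pairs of vertices that form an image edge are exactly the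
  images of pairs that form an edge, so the weights can be pulled back.\<close>
lemma edge_form_image:
  assumes "inj f"
  shows "edge_form ((`) f ` E) t d = edge_form E (\<lambda>v. t (f v)) (\<lambda>v. d (f v))"
proof -
  have "{(x, y). {x, y} \<in> (`) f ` E} = map_prod f f ` {(u, v). {u, v} \<in> E}" (is "?L = ?R")
  proof
    show "?L \<subseteq> ?R"
    proof clarify
      fix x y e assume *: "{x, y} = f ` e" "e \<in> E"
      then obtain u v where "x = f u" "y = f v" by blast
      with * have "{u, v} = e"
        using inj_image_eq_iff[OF assms, of "{u, v}" e] by simp
      with * \<open>x = f u\<close> \<open>y = f v\<close> show "(x, y) \<in> ?R" by force
    qed
    show "?R \<subseteq> ?L"
    proof
      fix p assume "p \<in> ?R"
      then obtain u v where "p = (f u, f v)" "{u, v} \<in> E" by auto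
      moreover from this(2) have "f ` {u, v} \<in> (`) f ` E" by (rule imageI)
      ultimately show "p \<in> ?L" by simp
    qed
  qed
  moreover have "inj_on (map_prod f f) {(u, v). {u, v} \<in> E}"
    using assms by (auto simp: inj_on_def)
  ultimately show ?thesis
    unfolding edge_form_def by (simp add: sum.reindex case_prod_unfold)
qed

lemma edge_form_cong:
  assumes "\<And>v. v \<in> \<Union> E \<Longrightarrow> t v = t' v \<and> d v = d' v"
  shows "edge_form E t d = edge_form E t' d'"
proof -
  have "t u = t' u \<and> t v = t' v \<and> d u = d' u \<and> d v = d' v" if "{u, v} \<in> E" for u v
    using assms[of u] assms[of v] that by blast
  then show ?thesis
    unfolding edge_form_def by (intro sum.cong refl) auto
qed

lemma comonotone_term_nonneg:
  fixes x y p q :: real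
  assumes "0 < p" "0 < q" "x \<le> y \<and> p \<le> q \<or> y \<le> x \<and> q \<le> p"
  shows "0 \<le> (x - y) * (1 / q - 1 / p)"
  using assms(3)
proof
  assume "x \<le> y \<and> p \<le> q"
  with assms show ?thesis by (intro mult_nonpos_nonpos) (auto intro: frac_le)
next
  assume "y \<le> x \<and> q \<le> p"
  with assms show ?thesis by (intro mult_nonneg_nonneg) (auto intro: frac_le)
qed

section \<open>Unions with one common vertex\<close>

text \<open>A common member of both image families would lie in the single common vertex, which is too
  small to contain an edge or a triangle.\<close>
lemma wedge_images_disjoint:
  assumes meet: "\<And>u v. f u = g v \<Longrightarrow> u = a" and two: "\<And>e. e \<in> F \<Longrightarrow> 2 \<le> card e"
  shows "(`) f ` F \<inter> (`) g ` H = {}"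
proof -
  have False if "e \<in> F" and eq: "f ` e = g ` h" for e h
  proof -
    have "u = a" if "u \<in> e" for u
    proof -
      have "f u \<in> g ` h" using that eq by blast
      then show "u = a" using meet by auto
    qed
    then have "card e \<le> card {a}" by (intro card_mono) auto
    with two[OF \<open>e \<in> F\<close>] show False by simp
  qed
  then show ?thesis by blast
qed

text \<open>Two structures are joined at one vertex by injective maps \<open>f\<close> and \<open>g\<close> whose images meet only in
  \<open>f a = g b\<close>. This form is symmetric in the two sides, so that one lemma gives the incidence numbers
  on both.\<close>
lemma incidence_wedge:
  assumes "inj f" "inj g" and meet: "\<And>u v. f u = g v \<longleftrightarrow> u = a \<and> v = b"
    and "finite F" "finite H" and two: "\<And>e. e \<in> F \<Longrightarrow> 2 \<le> card e"
  shows "incidence ((`) f ` F \<union> (`) g ` H) (f v) = incidence F v + (if v = a then incidence H b else 0)"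
proof -
  let ?F = "{e \<in> F. v \<in> e}" and ?H = "{e \<in> H. v = a \<and> b \<in> e}"
  have "{e \<in> (`) f ` F \<union> (`) g ` H. f v \<in> e} = (`) f ` ?F \<union> (`) g ` ?H"
    using meet by (auto simp: inj_image_mem_iff[OF assms(1)] inj_eq[OF assms(1)])
  moreover have "(`) f ` ?F \<inter> (`) g ` ?H = {}"
    by (rule wedge_images_disjoint[where a = a]) (use meet two in auto)
  moreover have "card ((`) f ` ?F) = card ?F" "card ((`) g ` ?H) = card ?H"
    using assms(1,2) by (auto intro!: card_image simp: inj_on_def inj_image_eq_iff)
  ultimately show ?thesis
    using assms(4,5) by (simp add: incidence_def card_Un_disjoint)
qed

text \<open>A triangle cannot be spread over both sides: if its edge \<open>x y\<close> lies on the \<open>f\<close>-side and, say,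
  \<open>x z\<close> on the \<open>g\<close>-side, then \<open>x\<close> is the common vertex \<open>c\<close>. The third edge \<open>y z\<close> then puts either
  \<open>y\<close> or \<open>z\<close> on both sides, so that it would equal \<open>c = x\<close>.\<close>
lemma triangle_wedge_cases:
  assumes meet: "\<And>u v. f u = g v \<Longrightarrow> f u = c"
    and xy: "{x, y} \<in> (`) f ` E" and rest: "{x, z} \<in> (`) f ` E \<union> (`) g ` F" "{y, z} \<in> (`) f ` E \<union> (`) g ` F"
    and ne: "x \<noteq> y" "x \<noteq> z" "y \<noteq> z"
  shows "{x, z} \<in> (`) f ` E \<and> {y, z} \<in> (`) f ` E"
proof -
  have f: "p \<in> range f \<and> q \<in> range f" if "{p, q} \<in> (`) f ` E" for p q using that by blast
  have g: "p \<in> range g \<and> q \<in> range g" if "{p, q} \<in> (`) g ` F" for p q using that by blast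
  have c: "p = c" if "p \<in> range f" "p \<in> range g" for p using that meet by auto
  have "{p, z} \<in> (`) f ` E"
    if "{p, z} \<in> (`) f ` E \<union> (`) g ` F" "{q, z} \<in> (`) f ` E \<union> (`) g ` F"
      "p \<in> range f" "q \<in> range f" "p \<noteq> q" "p \<noteq> z" for p q
  proof (rule ccontr)
    assume "{p, z} \<notin> (`) f ` E"
    with that(1) have pz: "p \<in> range g" "z \<in> range g" using g by auto
    then have "p = c" using that(3) c by blast
    show False
    proof (cases "{q, z} \<in> (`) f ` E")
      case True
      then show False using f c[of z] pz \<open>p = c\<close> that(6) by blast
    next
      case False
      then show False using that(2,4,5) g c[of q] \<open>p = c\<close> by blast
    qed
  qed
  from this[of x y] this[of y x] show ?thesis using rest ne f[OF xy] by simp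
qed

lemma triangle_in_image:
  assumes "inj f" "\<forall>e\<in>edges G. e \<subseteq> verts G"
    and T: "card T = 3" "\<forall>x\<in>T. \<forall>y\<in>T. x \<noteq> y \<longrightarrow> {x, y} \<in> (`) f ` edges G"
  shows "T \<in> (`) f ` triangles G"
proof -
  have "T \<subseteq> f ` verts G"
  proof
    fix x assume "x \<in> T"
    moreover have "\<not> T \<subseteq> {x}" using T(1) card_mono[of "{x}" T] by auto
    ultimately obtain y where "y \<in> T" "x \<noteq> y" by blast
    with T(2) \<open>x \<in> T\<close> obtain e where "{x, y} = f ` e" "e \<in> edges G" by blast
    with assms(2) show "x \<in> f ` verts G" by blast
  qed
  then obtain S where S: "S \<subseteq> verts G" "T = f ` S" by (auto simp: subset_image_iff)
  have "card S = 3" using T(1) S(2) assms(1) by (simp add: card_image inj_on_subset)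
  moreover have "{u, v} \<in> edges G" if uv: "u \<in> S" "v \<in> S" "u \<noteq> v" for u v
  proof -
    have "f u \<noteq> f v" using uv assms(1) by (simp add: inj_eq)
    with T(2) S(2) uv have "f ` {u, v} \<in> (`) f ` edges G" by simp
    then show ?thesis using inj_image_eq_iff[OF assms(1)] by (metis imageE)
  qed
  ultimately show ?thesis using S by (auto simp: triangles_def)
qed

lemma image_triangle:
  assumes S: "S \<in> triangles G" and "inj f"
    and sub: "f ` verts G \<subseteq> verts K" "(`) f ` edges G \<subseteq> edges K"
  shows "f ` S \<in> triangles K"
proof -
  have "f ` S \<subseteq> verts K" "card (f ` S) = 3"
    using S sub(1) card_image[OF inj_on_subset[OF \<open>inj f\<close>]] by (auto simp: triangles_def)
  moreover have "{f u, f v} \<in> edges K" if "u \<in> S" "v \<in> S" "f u \<noteq> f v" for u v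
  proof -
    have "{u, v} \<in> edges G" using S that by (auto simp: triangles_def)
    then have "f ` {u, v} \<in> edges K" using sub(2) by blast
    then show ?thesis by simp
  qed
  ultimately show ?thesis by (auto simp: triangles_def)
qed

text \<open>Gluing at one vertex creates no new triangle, so triangle counts simply add there.\<close>
lemma triangles_wedge:
  assumes "inj f" "inj g" and meet: "\<And>u v. f u = g v \<Longrightarrow> f u = c"
    and G: "\<forall>e\<in>edges G. e \<subseteq> verts G" and H: "\<forall>e\<in>edges H. e \<subseteq> verts H"
  shows "triangles (Ugraph (f ` verts G \<union> g ` verts H) ((`) f ` edges G \<union> (`) g ` edges H))
    = (`) f ` triangles G \<union> (`) g ` triangles H" (is "triangles ?K = _")
proof (intro equalityI subsetI)
  fix T assume "T \<in> triangles ?K"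
  then have c3: "card T = 3" and E: "\<And>x y. x \<in> T \<Longrightarrow> y \<in> T \<Longrightarrow> x \<noteq> y \<Longrightarrow> {x, y} \<in> (`) f ` edges G \<union> (`) g ` edges H"
    by (auto simp: triangles_def)
  obtain x y z where T: "T = {x, y, z}" and ne: "x \<noteq> y" "x \<noteq> z" "y \<noteq> z"
    using c3 by (auto simp: card_3_iff)
  have rest: "{x, y} \<in> (`) f ` edges G \<union> (`) g ` edges H"
    "{x, z} \<in> (`) f ` edges G \<union> (`) g ` edges H" "{y, z} \<in> (`) f ` edges G \<union> (`) g ` edges H"
    using E[of x y] E[of x z] E[of y z] T ne by auto
  have meet': "g v = c" if "g v = f u" for u v using meet that by metis
  show "T \<in> (`) f ` triangles G \<union> (`) g ` triangles H"
  proof (cases "{x, y} \<in> (`) f ` edges G")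
    case True
    then have "{x, z} \<in> (`) f ` edges G \<and> {y, z} \<in> (`) f ` edges G"
      using triangle_wedge_cases[of f g c x y "edges G" z "edges H"] meet rest ne by blast
    with True have "\<forall>x\<in>T. \<forall>y\<in>T. x \<noteq> y \<longrightarrow> {x, y} \<in> (`) f ` edges G"
      unfolding T by (simp add: insert_commute)
    then show ?thesis using triangle_in_image[OF assms(1) G c3] by blast
  next
    case False
    then have xy: "{x, y} \<in> (`) g ` edges H" using rest by blast
    then have "{x, z} \<in> (`) g ` edges H \<and> {y, z} \<in> (`) g ` edges H"
      using triangle_wedge_cases[of g f c x y "edges H" z "edges G"] meet' rest ne by blast
    with xy have "\<forall>x\<in>T. \<forall>y\<in>T. x \<noteq> y \<longrightarrow> {x, y} \<in> (`) g ` edges H"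
      unfolding T by (simp add: insert_commute)
    then show ?thesis using triangle_in_image[OF assms(2) H c3] by blast
  qed
next
  fix T assume "T \<in> (`) f ` triangles G \<union> (`) g ` triangles H"
  then show "T \<in> triangles ?K"
    using image_triangle[of _ G f ?K] image_triangle[of _ H g ?K] assms(1,2) by auto
qed

section \<open>Degrees and triangles of a star with part of its rim\<close>

text \<open>The triangle also has this form, with \<open>n = 2\<close> and \<open>W\<close> the whole rim, which then has just one
  edge. Bounding \<open>card W\<close> instead of requiring \<open>W \<subset> rim n\<close> therefore treats both clauses of
  \<open>partially_completed_star\<close> uniformly.\<close>
definition star_completion :: "nat \<Rightarrow> nat set set \<Rightarrow> bool" where
  "star_completion n W \<longleftrightarrow> 2 \<le> n \<and> W \<subseteq> rim n \<and> W \<noteq> {} \<and> card W < n"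

lemma finite_rim: "finite (rim n)" and card_rim: "card (rim n) \<le> n"
proof -
  have eq: "rim n = (\<lambda>i. {i, if i = n then 1 else i + 1}) ` {1..n}"
    unfolding rim_def by (rule Setcompr_eq_image)
  show "finite (rim n)" unfolding eq by simp
  show "card (rim n) \<le> n" unfolding eq by (rule order.trans[OF card_image_le]) auto
qed

lemma partially_completed_starE:
  assumes "partially_completed_star n G"
  obtains W where "star_completion n W" "verts G = {0..n}" "edges G = spokes n \<union> W"
proof -
  have "{0} \<union> {1..n} = {0..n}" by auto
  then have n: "n > 1" and V: "verts G = {0..n}"
    using assms unfolding partially_completed_star_def by simp_all
  consider W where "W \<noteq> {}" "W \<subset> rim n" "edges G = spokes n \<union> W"
    | "n = 2" "edges G = {{0, 1}, {0, 2}, {1, 2}}"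
    using assms unfolding partially_completed_star_def by blast
  then show ?thesis
  proof cases
    case 1
    have "card W < n" using psubset_card_mono[OF finite_rim 1(2)] card_rim[of n] by simp
    with 1 n have "star_completion n W" by (simp add: star_completion_def psubset_imp_subset)
    with 1(3) V that show ?thesis by blast
  next
    case 2
    have "{1..2::nat} = {1, 2}" by auto
    then have "spokes 2 = {{0, 1}, {0, 2}}"
      unfolding spokes_def Setcompr_eq_image by simp
    have "{1, 2::nat} \<in> rim 2"
      unfolding rim_def by (intro CollectI exI[of _ 1]) (simp add: numeral_2_eq_2)
    then have "star_completion n {{1, 2}}" using 2 by (simp add: star_completion_def)
    moreover have "edges G = spokes n \<union> {{1, 2}}"
      using 2 \<open>spokes 2 = _\<close> by (simp add: insert_commute)
    ultimately show ?thesis using V that by blast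
  qed
qed

lemma rim_edgeE:
  assumes "e \<in> rim n" "2 \<le> n"
  obtains i j where "e = {i, j}" "i \<noteq> j" "i \<in> {1..n}" "j \<in> {1..n}"
proof -
  obtain i where "e = {i, if i = n then 1 else i + 1}" "1 \<le> i" "i \<le> n"
    using assms(1) by (auto simp: rim_def)
  with assms(2) show ?thesis
    by (intro that[of i "if i = n then 1 else i + 1"]) (auto split: if_splits)
qed

context
  fixes n :: nat and W :: "nat set set"
  assumes star: "star_completion n W"
begin

lemma n_ge_2: "2 \<le> n" and W_rim: "W \<subseteq> rim n" and W_nonempty: "W \<noteq> {}" and card_W: "card W < n"
  using star by (auto simp: star_completion_def)

lemma finite_W: "finite W"
  using W_rim finite_rim by (rule finite_subset)

lemma card_W_pos: "0 < card W"
  using W_nonempty finite_W by (simp add: card_gt_0_iff)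

lemma W_edgeE:
  assumes "e \<in> W"
  obtains i j where "e = {i, j}" "i \<noteq> j" "i \<in> {1..n}" "j \<in> {1..n}"
  using rim_edgeE[of e n] assms W_rim n_ge_2 by blast

lemma zero_notin_W: "e \<in> W \<Longrightarrow> 0 \<notin> e"
  by (erule W_edgeE) auto

lemma incidence_W_le: "incidence W i \<le> card W"
  unfolding incidence_def by (rule card_mono[OF finite_W]) auto

lemma incidence_W_le_2: "incidence W i \<le> 2"
proof -
  have "{e \<in> W. i \<in> e} \<subseteq> {{i, if i = n then 1 else i + 1}, {if i = 1 then n else i - 1, i}}"
    using W_rim by (auto simp: rim_def split: if_splits)
  then have "incidence W i \<le> card {{i, if i = n then 1 else i + 1}, {if i = 1 then n else i - 1, i}}"
    unfolding incidence_def by (intro card_mono) auto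
  also have "\<dots> \<le> 2" by (simp add: card_insert_if)
  finally show ?thesis .
qed

text \<open>The handshake count: every rim edge is seen from its two endpoints.\<close>
lemma sum_incidence_W: "(\<Sum>i=1..n. incidence W i) = 2 * card W"
proof -
  have "(\<Sum>i=1..n. incidence W i) = (\<Sum>i=1..n. \<Sum>e\<in>W. if i \<in> e then 1 else 0)"
    using finite_W by (simp add: incidence_def sum.If_cases Int_def)
  also have "\<dots> = (\<Sum>e\<in>W. \<Sum>i=1..n. if i \<in> e then 1 else 0)" by (rule sum.swap)
  also have "\<dots> = (\<Sum>e\<in>W. 2)"
  proof (rule sum.cong)
    fix e assume "e \<in> W"
    then obtain i j where "e = {i, j}" "i \<noteq> j" "i \<in> {1..n}" "j \<in> {1..n}" by (rule W_edgeE)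
    then have "{1..n} \<inter> e = e" "card e = 2" by auto
    then show "(\<Sum>i=1..n. if i \<in> e then 1 else 0) = (2::nat)"
      by (simp add: sum.If_cases)
  qed simp
  finally show ?thesis by simp
qed

lemma spokes_W_disjoint: "spokes n \<inter> W = {}"
  using zero_notin_W by (auto simp: spokes_def)

lemma degree_center: "incidence (spokes n \<union> W) 0 = n"
proof -
  have "{e \<in> spokes n \<union> W. 0 \<in> e} = (\<lambda>i. {0, i}) ` {1..n}"
    using zero_notin_W by (auto simp: spokes_def)
  then show ?thesis
    by (simp add: incidence_def) (subst card_image, auto simp: inj_on_def doubleton_eq_iff)
qed

lemma degree_rim:
  assumes "i \<in> {1..n}"
  shows "incidence (spokes n \<union> W) i = incidence W i + 1"
proof -
  have "{e \<in> spokes n \<union> W. i \<in> e} = insert {0, i} {e \<in> W. i \<in> e}"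
    using assms by (auto simp: spokes_def)
  moreover have "{0, i} \<notin> W" using zero_notin_W by blast
  ultimately show ?thesis using finite_W by (simp add: incidence_def)
qed

text \<open>Every triangle consists of the center and a rim edge. The only way to avoid the center would
  be a rim that is itself a triangle; that forces \<open>n = 3\<close> and needs all three rim edges, whereas
  fewer than \<open>n\<close> are present.\<close>
lemma triangles_star:
  assumes "verts G = {0..n}" "edges G = spokes n \<union> W"
  shows "triangles G = insert 0 ` W"
proof (intro equalityI subsetI)
  fix T assume "T \<in> insert 0 ` W"
  then obtain e where e: "e \<in> W" "T = insert 0 e" by blast
  then obtain i j where ij: "e = {i, j}" "i \<noteq> j" "i \<in> {1..n}" "j \<in> {1..n}" by (blast elim: W_edgeE)
  moreover have "{0, i} \<in> spokes n" "{0, j} \<in> spokes n" using ij by (auto simp: spokes_def)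
  ultimately show "T \<in> triangles G"
    using e assms by (auto simp: triangles_def insert_commute)
next
  fix T assume "T \<in> triangles G"
  then have T: "card T = 3" "T \<subseteq> {0..n}"
    and E: "\<And>u v. u \<in> T \<Longrightarrow> v \<in> T \<Longrightarrow> u \<noteq> v \<Longrightarrow> {u, v} \<in> spokes n \<union> W"
    using assms by (auto simp: triangles_def)
  have W: "{u, v} \<in> W" if "u \<in> T" "v \<in> T" "u < v" "0 < u" for u v
    using E[of u v] that by (auto simp: spokes_def doubleton_eq_iff)
  obtain i j k where ijk: "T = {i, j, k}" "i < j" "j < k"
  proof -
    obtain x y z where "T = {x, y, z}" "x \<noteq> y" "x \<noteq> z" "y \<noteq> z"
      using T(1) by (auto simp: card_3_iff)
    then show ?thesis
      using that[of x y z] that[of x z y] that[of y x z] that[of y z x] that[of z x y] that[of z y x]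
      by (simp add: insert_commute) linarith
  qed
  have "{j, k} \<in> W" using W[of j k] ijk by auto
  show "T \<in> insert 0 ` W"
  proof (cases "i = 0")
    case True
    then show ?thesis using \<open>{j, k} \<in> W\<close> ijk by auto
  next
    case False
    then have sub: "{{i, j}, {j, k}, {i, k}} \<subseteq> W" using W ijk by simp
    (* Of the three gaps, i k is at least 2 and must be the edge that closes the cycle. *)
    have rim: "v = u + 1 \<or> u = 1 \<and> v = n" if "{u, v} \<in> W" "u < v" for u v
      using that W_rim by (fastforce simp: rim_def doubleton_eq_iff split: if_splits)
    have "k \<le> n" using T(2) ijk by auto
    then have "n = 3" using rim[of i j] rim[of j k] rim[of i k] sub ijk False by auto
    moreover have "card {{i, j}, {j, k}, {i, k}} = 3"
      using ijk by (simp add: doubleton_eq_iff)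
    then have "3 \<le> card W" using card_mono[OF finite_W sub] by simp
    ultimately show ?thesis using card_W by simp
  qed
qed

lemma inj_on_insert_center: "inj_on (insert 0) W"
  using zero_notin_W by (auto simp: inj_on_def insert_ident)

lemma triangles_at_center: "incidence (insert 0 ` W) 0 = card W"
proof -
  have "card (insert 0 ` W) = card W" using inj_on_insert_center by (rule card_image)
  moreover have "{T \<in> insert 0 ` W. 0 \<in> T} = insert 0 ` W" by auto
  ultimately show ?thesis by (simp add: incidence_def)
qed

lemma triangles_at_rim:
  assumes "i \<noteq> 0"
  shows "incidence (insert 0 ` W) i = incidence W i"
proof -
  have "inj_on (insert 0) {e \<in> W. i \<in> e}"
    using inj_on_insert_center by (rule inj_on_subset) auto
  then have "card (insert 0 ` {e \<in> W. i \<in> e}) = card {e \<in> W. i \<in> e}" by (rule card_image)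
  moreover have "{T \<in> insert 0 ` W. i \<in> T} = insert 0 ` {e \<in> W. i \<in> e}" using assms by auto
  ultimately show ?thesis by (simp add: incidence_def)
qed

end

section \<open>One side of the glued graph\<close>
lemma edge_form_spokes:
  "edge_form (spokes n) t d = 2 * (\<Sum>i=1..n. (t 0 - t i) * (1 / d i - 1 / d 0))"
proof -
  let ?h = "\<lambda>(u, v). (t u - t v) * (1 / d v - 1 / d u)"
  let ?out = "Pair 0 ` {1..n}" and ?in = "(\<lambda>i. (i, 0)) ` {1..n}"
  have "{(u, v). {u, v} \<in> spokes n} = ?out \<union> ?in"
    by (auto simp: spokes_def doubleton_eq_iff)
  then have "edge_form (spokes n) t d = sum ?h (?out \<union> ?in)"
    by (simp add: edge_form_def)
  also have "\<dots> = sum ?h ?out + sum ?h ?in"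
    by (rule sum.union_disjoint) auto
  also have "sum ?h ?out = (\<Sum>i=1..n. (t 0 - t i) * (1 / d i - 1 / d 0))"
    by (subst sum.reindex) (auto simp: inj_on_def)
  also have "sum ?h ?in = (\<Sum>i=1..n. (t 0 - t i) * (1 / d i - 1 / d 0))"
    by (subst sum.reindex) (auto simp: inj_on_def algebra_simps intro!: sum.cong)
  finally show ?thesis by simp
qed

text \<open>The weights are those of a star whose vertex \<open>a\<close> receives, from the other side of the gluing,
  \<open>m\<close> further triangles and \<open>m + 1\<close> further edges: a rim vertex with \<open>m\<close> rim edges lies in \<open>m\<close>
  triangles and has one spoke in addition. The inequality holds for arbitrary \<open>m\<close>, which is why the
  two sides of the glued graph can be treated separately.\<close>
lemma edge_form_star_nonneg:
  fixes t d :: "nat \<Rightarrow> real"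
  assumes star: "star_completion n W" and a: "a \<in> {1..n}"
    and t: "\<And>v. t v = real (incidence (insert 0 ` W) v + (if v = a then m else 0))"
    and d: "\<And>v. d v = real (incidence (spokes n \<union> W) v + (if v = a then m + 1 else 0))"
  shows "0 \<le> edge_form (spokes n \<union> W) t d"
proof -
  define r w where "r = incidence W" and "w = card W"
  define s where "s = r a + m"
  have a0: "a \<noteq> 0" using a by simp
  have n: "2 \<le> n" and w: "1 \<le> w" "w < n"
    using n_ge_2[OF star] card_W_pos[OF star] card_W[OF star] by (auto simp: w_def)
  have r: "r i \<le> 2" "r i \<le> w" for i
    using incidence_W_le_2[OF star] incidence_W_le[OF star] by (auto simp: r_def w_def)
  have at_center: "t 0 = w" "d 0 = n"
    using a0 degree_center[OF star] triangles_at_center[OF star] by (simp_all add: t d w_def)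
  have at_rim: "t i = r i" "d i = r i + 1" if "i \<in> {1..n} - {a}" for i
    using that degree_rim[OF star] triangles_at_rim[OF star] by (simp_all add: t d r_def)
  have at_a: "t a = s" "d a = s + 2"
    using a a0 degree_rim[OF star] triangles_at_rim[OF star] by (simp_all add: t d r_def s_def)
  have rim_part: "0 \<le> edge_form W t d"
    unfolding edge_form_def
  proof (intro sum_nonneg, clarify)
    fix u v assume "{u, v} \<in> W"
    then have uv: "u \<in> {1..n}" "v \<in> {1..n}" "u \<noteq> v"
      using W_edgeE[OF star, of "{u, v}"] by (metis doubleton_eq_iff)+
    (* Against a rim vertex, the vertex a compares r with s and r + 1 with s + 2: if s < r then
       s + 2 <= r + 1, and if r <= s then r + 1 <= s + 2. *)
    then consider "u \<noteq> a" "v \<noteq> a" | "u = a" "v \<noteq> a" | "u \<noteq> a" "v = a" by blast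
    then show "0 \<le> (t u - t v) * (1 / d v - 1 / d u)"
    proof cases
      case 1
      then show ?thesis
        using uv at_rim[of u] at_rim[of v] by (intro comonotone_term_nonneg) auto
    next
      case 2
      then show ?thesis
        using uv at_a at_rim[of v] by (intro comonotone_term_nonneg) auto
    next
      case 3
      then show ?thesis
        using uv at_a at_rim[of u] by (intro comonotone_term_nonneg) auto
    qed
  qed
  (* The contribution of the spoke to i. *)
  define p where "p = (\<lambda>i. (t 0 - t i) * (1 / d i - 1 / d 0))"
  have p_rim: "p i = (real w - r i) * (1 / (real (r i) + 1) - 1 / n)" if "i \<in> {1..n} - {a}" for i
    using that at_center at_rim[of i] by (simp add: p_def)
  have p_a: "p a = (real w - s) * (1 / (real s + 2) - 1 / n)"
    using at_center at_a by (simp add: p_def)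
  have p_rim_nonneg: "0 \<le> p i" if "i \<in> {1..n} - {a}" for i
    unfolding p_rim[OF that] using r[of i] w n by (intro comonotone_term_nonneg) auto
  have split: "(\<Sum>i=1..n. p i) = p a + (\<Sum>i\<in>{1..n} - {a}. p i)"
    using a by (simp add: sum.remove)
  have spoke_part: "0 \<le> (\<Sum>i=1..n. p i)"
  proof (cases "w < s \<and> s + 2 < n")
    case False
    (* If s < w then s + 2 <= w + 1 <= n, so the degrees are ordered like the triangle counts. *)
    then have "0 \<le> p a"
      unfolding p_a using w n by (intro comonotone_term_nonneg) auto
    with p_rim_nonneg show ?thesis unfolding split by (intro add_nonneg_nonneg sum_nonneg)
  next
    case True
    (* The spoke to a is negative here, and the others have to outweigh it. *)
    have "(\<Sum>i\<in>{1..n} - {a}. real (r i)) \<le> (\<Sum>i=1..n. real (r i))"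
      by (rule sum_mono2) auto
    also have "\<dots> = 2 * real w"
      using sum_incidence_W[OF star] by (simp add: r_def w_def flip: of_nat_sum)
    finally have "(\<Sum>i\<in>{1..n} - {a}. real w - r i) \<ge> (real n - 1) * w - 2 * w"
      using a n by (simp add: sum_subtractf of_nat_diff)
    moreover have "(real n - 3) * 1 \<le> (real n - 3) * w"
      using True w by (intro mult_left_mono) auto
    ultimately have mass: "(\<Sum>i\<in>{1..n} - {a}. real w - r i) \<ge> real n - 3"
      by (simp add: algebra_simps)
    have "1 / (real s + 2) \<le> 1 / 3" using True by (intro frac_le) auto
    moreover have "1 / real n \<le> 1 / (real s + 2)" using True by (intro frac_le) auto
    ultimately have third: "1 / (real s + 2) \<le> 1 / 3" "1 / real n \<le> 1 / (real s + 2)" "1 / real n \<le> 1 / 3"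
      by linarith+
    have "- p a = (real s - w) * (1 / (real s + 2) - 1 / n)"
      unfolding p_a by (simp only: mult_minus_left[symmetric] minus_diff_eq)
    also have "\<dots> \<le> (real n - 3) * (1 / 3 - 1 / n)"
      using True w third by (intro mult_mono diff_right_mono) auto
    also have "\<dots> \<le> (\<Sum>i\<in>{1..n} - {a}. real w - r i) * (1 / 3 - 1 / n)"
      using mass third(3) by (intro mult_right_mono) auto
    also have "\<dots> \<le> (\<Sum>i\<in>{1..n} - {a}. p i)"
      unfolding sum_distrib_right
    proof (rule sum_mono)
      fix i assume i: "i \<in> {1..n} - {a}"
      have "1 / 3 \<le> 1 / (real (r i) + 1)" using r(1)[of i] by (intro frac_le) auto
      then show "(real w - r i) * (1 / 3 - 1 / n) \<le> p i"
        unfolding p_rim[OF i] using r(2)[of i] by (intro mult_left_mono diff_right_mono) auto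
    qed
    finally show ?thesis unfolding split by simp
  qed
  have "finite (\<Union> (spokes n))" "finite (\<Union> W)"
  proof -
    have "\<Union> (spokes n) \<subseteq> {0..n}" by (auto simp: spokes_def)
    moreover have "\<Union> W \<subseteq> {0..n}" by (auto elim: W_edgeE[OF star])
    ultimately show "finite (\<Union> (spokes n))" "finite (\<Union> W)" by (auto elim: finite_subset)
  qed
  then have "edge_form (spokes n \<union> W) t d = 2 * (\<Sum>i=1..n. p i) + edge_form W t d"
    using spokes_W_disjoint[OF star] by (simp add: edge_form_Un edge_form_spokes p_def)
  with rim_part spoke_part show ?thesis by simp
qed

section \<open>The glued graph\<close>
lemma glue_map_meet: "Inl u = glue_map a b v \<longleftrightarrow> u = a \<and> v = b"
  by (auto simp: glue_map_def)

lemma finite_edges: "simple_graph G \<Longrightarrow> finite (edges G)"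
  by (rule finite_subset[of _ "Pow (verts G)"]) (auto simp: simple_graph_def)

lemma finite_triangles: "simple_graph G \<Longrightarrow> finite (triangles G)"
  by (rule finite_subset[of _ "Pow (verts G)"]) (auto simp: simple_graph_def triangles_def)

lemma finite_Union_image_edges:
  assumes "simple_graph G"
  shows "finite (\<Union> ((`) h ` edges G))"
proof (rule finite_subset)
  show "\<Union> ((`) h ` edges G) \<subseteq> h ` verts G" using assms by (fastforce simp: simple_graph_def)
  show "finite (h ` verts G)" using assms by (simp add: simple_graph_def)
qed

lemma edge_form_glue:
  assumes "simple_graph G" "simple_graph H"
  shows "edge_form (edges (glue G a H b)) t d
    = edge_form (edges G) (\<lambda>v. t (Inl v)) (\<lambda>v. d (Inl v))
    + edge_form (edges H) (\<lambda>v. t (glue_map a b v)) (\<lambda>v. d (glue_map a b v))"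
proof -
  have "(`) Inl ` edges G \<inter> (`) (glue_map a b) ` edges H = {}"
    by (rule wedge_images_disjoint[where a = a])
      (use assms(1) in \<open>simp_all add: glue_map_meet simple_graph_def\<close>)
  then show ?thesis
    using assms unfolding glue_def
    by (simp add: edge_form_Un edge_form_image inj_glue_map finite_Union_image_edges)
qed

lemma incidence_glue:
  assumes "finite F" "finite H" "\<And>e. e \<in> F \<Longrightarrow> 2 \<le> card e" "\<And>e. e \<in> H \<Longrightarrow> 2 \<le> card e"
  shows "incidence ((`) Inl ` F \<union> (`) (glue_map a b) ` H) (Inl v)
      = incidence F v + (if v = a then incidence H b else 0)"
    and "incidence ((`) Inl ` F \<union> (`) (glue_map a b) ` H) (glue_map a b v)
      = incidence H v + (if v = b then incidence F a else 0)"
proof -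
  have meet: "glue_map a b u = Inl v \<longleftrightarrow> u = b \<and> v = a" for u v
    using glue_map_meet[of v a b u] by metis
  show "incidence ((`) Inl ` F \<union> (`) (glue_map a b) ` H) (Inl v)
      = incidence F v + (if v = a then incidence H b else 0)"
    by (rule incidence_wedge) (simp_all add: assms glue_map_meet inj_glue_map)
  show "incidence ((`) Inl ` F \<union> (`) (glue_map a b) ` H) (glue_map a b v)
      = incidence H v + (if v = b then incidence F a else 0)"
    by (subst Un_commute, rule incidence_wedge) (simp_all add: assms meet inj_glue_map)
qed

lemma triangles_glue:
  assumes "simple_graph G" "simple_graph H"
  shows "triangles (glue G a H b) = (`) Inl ` triangles G \<union> (`) (glue_map a b) ` triangles H"
  unfolding glue_def using assms
  by (intro triangles_wedge[where c = "Inl a"]) (auto simp: inj_glue_map glue_map_meet simple_graph_def)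

lemma card_verts_glue:
  assumes "finite (verts G)" "finite (verts H)" "a \<in> verts G" "b \<in> verts H"
  shows "card (verts (glue G a H b)) + 1 = card (verts G) + card (verts H)"
proof -
  have "Inl ` verts G \<inter> glue_map a b ` verts H = {Inl a}"
    using assms(3,4) by (auto simp: glue_map_def split: if_splits)
  moreover have "card (glue_map a b ` verts H) = card (verts H)"
    by (rule card_image) (metis inj_glue_map inj_on_subset subset_UNIV)
  moreover have "card (Inl ` verts G :: ('a + 'b) set) = card (verts G)" by (rule card_image) simp
  ultimately show ?thesis
    using card_Un_Int[of "Inl ` verts G" "glue_map a b ` verts H"] assms(1,2) by (simp add: glue_def)
qed

theorem theorem2:
  fixes n1 n2 a b :: nat and G1 G2 :: "nat ugraph"
  assumes "partially_completed_star n1 G1"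
    and "partially_completed_star n2 G2"
    and "triangles G1 \<noteq> {}"
    and "triangles G2 \<noteq> {}"
    and "a \<in> verts G1" and "a \<noteq> 0"
    and "b \<in> verts G2" and "b \<noteq> 0"
  shows "card (verts (glue G1 a G2 b)) = n1 + n2 + 1 \<and>
         triangle_friendship_paradox (glue G1 a G2 b)"
proof
  obtain W1 where W1: "star_completion n1 W1" and V1: "verts G1 = {0..n1}" and E1: "edges G1 = spokes n1 \<union> W1"
    using assms(1) by (rule partially_completed_starE)
  obtain W2 where W2: "star_completion n2 W2" and V2: "verts G2 = {0..n2}" and E2: "edges G2 = spokes n2 \<union> W2"
    using assms(2) by (rule partially_completed_starE)
  have a: "a \<in> {1..n1}" and b: "b \<in> {1..n2}" using assms(5-8) V1 V2 by auto
  let ?K = "glue G1 a G2 b"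
  show "card (verts ?K) = n1 + n2 + 1"
    using card_verts_glue[of G1 G2 a b] assms(5,7) V1 V2 by simp

  have simple: "simple_graph G1" "simple_graph G2"
    using assms(1,2) by (auto intro: partially_completed_star_simple)
  then have simple_K: "simple_graph ?K" by (rule simple_graph_glue)
  have T1: "triangles G1 = insert 0 ` W1" and T2: "triangles G2 = insert 0 ` W2"
    using triangles_star[OF W1 V1 E1] triangles_star[OF W2 V2 E2] by auto
  have card_edge: "2 \<le> card e" if "e \<in> edges G1 \<union> edges G2" for e
    using that simple by (auto simp: simple_graph_def)
  have card_triangle: "2 \<le> card T" if "T \<in> triangles G1 \<union> triangles G2" for T
    using that by (auto simp: triangles_def)

  let ?t = "\<lambda>v. real (triangle_count ?K v)" and ?d = "\<lambda>v. real (vertex_degree ?K v)"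
  have edges_K: "edges ?K = (`) Inl ` edges G1 \<union> (`) (glue_map a b) ` edges G2"
    by (simp add: glue_def)
  have deg_b: "incidence (edges G2) b = incidence W2 b + 1" and deg_a: "incidence (edges G1) a = incidence W1 a + 1"
    using degree_rim[OF W1 a] degree_rim[OF W2 b] by (simp_all add: E1 E2)
  have tri_b: "incidence (triangles G2) b = incidence W2 b" and tri_a: "incidence (triangles G1) a = incidence W1 a"
    using triangles_at_rim[OF W1] triangles_at_rim[OF W2] assms(6,8) by (simp_all add: T1 T2)
  note inc_edges = incidence_glue[OF finite_edges[OF simple(1)] finite_edges[OF simple(2)] card_edge card_edge]
  note inc_triangles =
    incidence_glue[OF finite_triangles[OF simple(1)] finite_triangles[OF simple(2)] card_triangle card_triangle]
  have t1: "?t (Inl v) = real (incidence (triangles G1) v + (if v = a then incidence W2 b else 0))"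
    and t2: "?t (glue_map a b v) = real (incidence (triangles G2) v + (if v = b then incidence W1 a else 0))" for v
    by (simp_all add: triangle_count_eq_incidence triangles_glue[OF simple] inc_triangles tri_a tri_b)
  have d1: "?d (Inl v) = real (incidence (edges G1) v + (if v = a then incidence W2 b + 1 else 0))"
    and d2: "?d (glue_map a b v) = real (incidence (edges G2) v + (if v = b then incidence W1 a + 1 else 0))" for v
    by (simp_all add: vertex_degree_eq_incidence[OF simple_K] edges_K inc_edges deg_a deg_b)

  have "0 \<le> edge_form (edges G1) (\<lambda>v. ?t (Inl v)) (\<lambda>v. ?d (Inl v))"
    using edge_form_star_nonneg[OF W1 a t1[unfolded T1] d1[unfolded E1]] by (simp only: E1)
  moreover have "0 \<le> edge_form (edges G2) (\<lambda>v. ?t (glue_map a b v)) (\<lambda>v. ?d (glue_map a b v))"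
    using edge_form_star_nonneg[OF W2 b t2[unfolded T2] d2[unfolded E2]] by (simp only: E2)
  ultimately have "0 \<le> (\<Sum>v\<in>verts ?K. triangle_bias_at ?K v)"
    using sum_triangle_bias_at[OF simple_K] edge_form_glue[OF simple] by simp
  then show "triangle_friendship_paradox ?K"
    by (simp add: triangle_friendship_paradox_def triangle_bias_def)
qed

end
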